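(* There exists a locally countable, locally compact, $0$-dimensional $T_2$ D-space $X$ of cardinality $2^\omega$ which does not satisfy the following property $( * )$: for every regular uncountable cardinal $\kappa$ and every $A\subseteq X$ with $|A|=\kappa$, either $A$ has a complete accumulation point in $X$, or $A$ has a subset of size $\kappa$ which is closed discrete in $X$.
   Context: A space is locally countable if every point has a countable neighborhood; it is $0$-dimensional if it has a base of clopen sets. A subset of a space is closed discrete if it is closed and discrete in the subspace topology. A point $x\in X$ is a complete accumulation point of $A$ if $|U\cap A|=|A|$ for every neighborhood $U$ of $x$. An open neighborhood assignment (ONA) on $(X,\tau)$ is a map $U:X\to\tau$ with $x\in U(x)$ for all $x\in X$. $X$ is a D-space if for every ONA $U$ there is a closed discrete $D\subseteq X$ with $X=\bigcup_{d\in D}U(d)$. *)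

theory Defs
  imports "HOL-Analysis.Analysis"
begin

unbundle cardinal_syntax

text \<open>Neighborhoods are not required to be open.\<close>

definition neighborhood_of :: "'a topology \<Rightarrow> 'a \<Rightarrow> 'a set \<Rightarrow> bool" where
  "neighborhood_of X x N \<longleftrightarrow>
     N \<subseteq> topspace X \<and> (\<exists>V. openin X V \<and> x \<in> V \<and> V \<subseteq> N)"

definition locally_countable_space :: "'a topology \<Rightarrow> bool" where
  "locally_countable_space X \<longleftrightarrow>
     (\<forall>x \<in> topspace X. \<exists>N. neighborhood_of X x N \<and> countable N)"

definition topology_base :: "'a topology \<Rightarrow> 'a set set \<Rightarrow> bool" where
  "topology_base X \<B> \<longleftrightarrow>
     (\<forall>B \<in> \<B>. openin X B) \<and>
     (\<forall>V x. openin X V \<and> x \<in> V \<longrightarrow> (\<exists>B \<in> \<B>. x \<in> B \<and> B \<subseteq> V))"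

definition zero_dimensional_space :: "'a topology \<Rightarrow> bool" where
  "zero_dimensional_space X \<longleftrightarrow>
     (\<exists>\<B>. topology_base X \<B> \<and> (\<forall>B \<in> \<B>. openin X B \<and> closedin X B))"

definition closed_discrete_in :: "'a topology \<Rightarrow> 'a set \<Rightarrow> bool" where
  "closed_discrete_in X D \<longleftrightarrow>
     closedin X D \<and> subtopology X D = discrete_topology D"

definition open_neighborhood_assignment :: "'a topology \<Rightarrow> ('a \<Rightarrow> 'a set) \<Rightarrow> bool" where
  "open_neighborhood_assignment X U \<longleftrightarrow>
     (\<forall>x \<in> topspace X. openin X (U x) \<and> x \<in> U x)"

definition D_space :: "'a topology \<Rightarrow> bool" where
  "D_space X \<longleftrightarrow>
     (\<forall>U. open_neighborhood_assignment X U \<longrightarrow>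
        (\<exists>D. closed_discrete_in X D \<and> topspace X = (\<Union>d\<in>D. U d)))"

definition complete_accumulation_point :: "'a topology \<Rightarrow> 'a set \<Rightarrow> 'a \<Rightarrow> bool" where
  "complete_accumulation_point X A x \<longleftrightarrow>
     x \<in> topspace X \<and> (\<forall>N. neighborhood_of X x N \<longrightarrow> |N \<inter> A| =o |A| )"

definition regular_uncountable_cardinal :: "'k rel \<Rightarrow> bool" where
  "regular_uncountable_cardinal \<kappa> \<longleftrightarrow>
     Card_order \<kappa> \<and> regularCard \<kappa> \<and> natLeq <o \<kappa>"

text \<open>Taking \<open>\<kappa>\<close> to be a cardinal on the type of the points loses no generality: if \<open>|A| =o \<kappa>\<close>
  for some \<open>A \<subseteq> topspace X\<close>, then \<open>\<kappa>\<close> is order-isomorphic to \<open>|A|\<close>, which lives on that type.\<close>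

definition property_star :: "'a topology \<Rightarrow> bool" where
  "property_star X \<longleftrightarrow>
     (\<forall>(\<kappa> :: 'a rel) A.
        regular_uncountable_cardinal \<kappa> \<and> A \<subseteq> topspace X \<and> |A| =o \<kappa> \<longrightarrow>
          (\<exists>x. complete_accumulation_point X A x) \<or>
          (\<exists>B \<subseteq> A. |B| =o \<kappa> \<and> closed_discrete_in X B))"

end

theory Submission
  imports Defs "HOL-Library.Countable_Set_Type"
begin

text \<open>The space is the Mrowka space of a maximal almost disjoint family of countable subsets of a
  set \<open>B\<close> of cardinality continuum. The points of \<open>B\<close> are isolated and the remaining points form a
  closed discrete set \<open>J\<close>, so for any neighborhood assignment \<open>U\<close> the set \<open>J\<close> together with the
  points of \<open>B\<close> not covered by \<open>U\<close> on \<open>J\<close> is a closed discrete kernel. An uncountable \<open>A \<subseteq> B\<close> has no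
  complete accumulation point because the space is locally countable, and by maximality no infinite
  subset of \<open>A\<close> is closed.\<close>

section \<open>Mrowka spaces\<close>

text \<open>The almost disjoint family is indexed by \<open>J\<close>, so that its members are
  represented by points of the type \<open>'a\<close> and can be adjoined to
  \<open>B\<close>.\<close>

locale mrowka =
  fixes B J :: "'a set" and L :: "'a \<Rightarrow> 'a set"
  assumes disjoint: "B \<inter> J = {}"
    and L_subset: "x \<in> J \<Longrightarrow> L x \<subseteq> B"
    and countable_L: "x \<in> J \<Longrightarrow> countable (L x)"
    and almost_disjoint: "\<lbrakk>x \<in> J; y \<in> J; x \<noteq> y\<rbrakk> \<Longrightarrow> finite (L x \<inter> L y)"
begin

text \<open>Each \<open>x\<close> in \<open>J\<close> is made a limit of \<open>L x\<close>: a
  neighborhood of \<open>x\<close> contains all but finitely many points of \<open>L x\<close>. If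
  \<open>L x\<close> is finite, \<open>x\<close> is isolated.\<close>

definition space :: "'a topology" where
  "space = topology (\<lambda>U. U \<subseteq> B \<union> J \<and> (\<forall>x\<in>U \<inter> J. finite (L x - U)))"

lemma openin_space: "openin space U \<longleftrightarrow> U \<subseteq> B \<union> J \<and> (\<forall>x\<in>U \<inter> J. finite (L x - U))"
proof -
  have "istopology (\<lambda>U. U \<subseteq> B \<union> J \<and> (\<forall>x\<in>U \<inter> J. finite (L x - U)))"
    unfolding istopology_def
  proof (intro conjI allI impI)
    fix S T
    assume "S \<subseteq> B \<union> J \<and> (\<forall>x\<in>S \<inter> J. finite (L x - S))"
      and "T \<subseteq> B \<union> J \<and> (\<forall>x\<in>T \<inter> J. finite (L x - T))"
    then show "S \<inter> T \<subseteq> B \<union> J" "\<forall>x\<in>S \<inter> T \<inter> J. finite (L x - S \<inter> T)"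
      by (auto simp: Diff_Int)
  next
    fix \<K>
    assume K: "\<forall>K\<in>\<K>. K \<subseteq> B \<union> J \<and> (\<forall>x\<in>K \<inter> J. finite (L x - K))"
    then show "\<Union>\<K> \<subseteq> B \<union> J" by blast
    show "\<forall>x\<in>\<Union>\<K> \<inter> J. finite (L x - \<Union>\<K>)"
    proof
      fix x assume "x \<in> \<Union>\<K> \<inter> J"
      then obtain K where "K \<in> \<K>" "x \<in> K" "x \<in> J" by blast
      then have "finite (L x - K)" using K by blast
      then show "finite (L x - \<Union>\<K>)"
        by (rule rev_finite_subset) (use \<open>K \<in> \<K>\<close> in blast)
    qed
  qed
  then show ?thesis by (simp add: space_def)
qed

lemma topspace_space: "topspace space = B \<union> J"
proof
  show "topspace space \<subseteq> B \<union> J"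
    using openin_space openin_topspace by blast
  have "openin space (B \<union> J)"
    unfolding openin_space using L_subset by (fastforce intro: finite_subset[of _ "{}"])
  then show "B \<union> J \<subseteq> topspace space" by (rule openin_subset)
qed

lemma closedin_space:
  "closedin space C \<longleftrightarrow> C \<subseteq> B \<union> J \<and> (\<forall>x\<in>J - C. finite (L x \<inter> C))"
proof -
  have "L x - (B \<union> J - C) = L x \<inter> C" if "x \<in> J" for x
    using L_subset[OF that] by blast
  then show ?thesis
    by (auto simp: closedin_def topspace_space openin_space)
qed

lemma clopen_singleton: "x \<in> B \<Longrightarrow> openin space {x} \<and> closedin space {x}"
  using disjoint by (auto simp: openin_space closedin_space)

text \<open>The only point of the set in \<open>J\<close> is \<open>x\<close>, so openness is a
  condition at \<open>x\<close> alone. For closedness, any other \<open>y\<close> in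
  \<open>J\<close> is tested, where almost disjointness of \<open>L x\<close> and \<open>L y\<close>
  suffices.\<close>

lemma clopen_neighborhood:
  assumes "x \<in> J" "finite F"
  shows "openin space (insert x (L x - F)) \<and> closedin space (insert x (L x - F))"
proof
  have "L x \<inter> J = {}" using L_subset disjoint assms(1) by blast
  then have "insert x (L x - F) \<inter> J = {x}" using assms(1) by blast
  moreover have "finite (L x - insert x (L x - F))"
    by (rule finite_subset[OF _ assms(2)]) blast
  ultimately show "openin space (insert x (L x - F))"
    using L_subset assms(1) by (auto simp: openin_space)
  have "finite (L y \<inter> insert x (L x - F))" if "y \<in> J" "y \<noteq> x" for y
    by (rule finite_subset[of _ "insert x (L x \<inter> L y)"])
      (use almost_disjoint[of x y] that assms(1) in auto)
  then show "closedin space (insert x (L x - F))"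
    using L_subset assms(1) by (auto simp: closedin_space)
qed

lemma clopen_base:
  assumes "openin space V" "x \<in> V"
  obtains W where "openin space W" "closedin space W" "x \<in> W" "W \<subseteq> V" "countable W"
proof (cases "x \<in> B")
  case True
  then show ?thesis using that[of "{x}"] clopen_singleton assms by auto
next
  case False
  then have x: "x \<in> J" "finite (L x - V)" using assms by (auto simp: openin_space)
  \<comment> \<open>Discarding the finite set \<open>L x - V\<close> puts the basic neighborhood
    inside \<open>V\<close>.\<close>
  then show ?thesis
    using that[of "insert x (L x - (L x - V))"] clopen_neighborhood[OF x] countable_L assms(2)
    by auto
qed

section \<open>Topological properties of the space\<close>

lemma locally_countable: "locally_countable_space space"
  unfolding locally_countable_space_def neighborhood_of_def
  by (meson clopen_base openin_topspace openin_subset order_refl)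

lemma zero_dimensional: "zero_dimensional_space space"
  unfolding zero_dimensional_space_def topology_base_def
  by (rule exI[of _ "{W. openin space W \<and> closedin space W}"]) (blast elim: clopen_base)

lemma locally_compact: "locally_compact_space space"
  unfolding locally_compact_space_def
proof
  fix x assume "x \<in> topspace space"
  then consider "x \<in> B" | "x \<in> J" by (auto simp: topspace_space)
  then show "\<exists>U K. openin space U \<and> compactin space K \<and> x \<in> U \<and> U \<subseteq> K"
  proof cases
    case 1
    then show ?thesis
      using clopen_singleton[of x] finite_imp_compactin[where X = space and S = "{x}"]
      by (intro exI[of _ "{x}"]) (auto simp: topspace_space)
  next
    case 2
    \<comment> \<open>\<open>?K\<close> is a convergent sequence with its limit, or finite: one
      member of a cover contains \<open>x\<close> and hence almost all of \<open>?K\<close>.\<close>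
    let ?K = "insert x (L x)"
    have K: "openin space ?K" using clopen_neighborhood[OF 2, of "{}"] by simp
    have "compactin space ?K"
      unfolding compactin_def
    proof (intro conjI allI impI)
      show "?K \<subseteq> topspace space" using K by (rule openin_subset)
      fix \<U> assume U: "Ball \<U> (openin space) \<and> ?K \<subseteq> \<Union>\<U>"
      then obtain u where u: "u \<in> \<U>" "x \<in> u" by blast
      then have "finite (L x - u)" using U 2 by (auto simp: openin_space)
      moreover have "L x - u \<subseteq> \<Union>\<U>" using U by blast
      ultimately obtain \<F> where "finite \<F>" "\<F> \<subseteq> \<U>" "L x - u \<subseteq> \<Union>\<F>"
        by (meson finite_subset_Union)
      then show "\<exists>\<F>. finite \<F> \<and> \<F> \<subseteq> \<U> \<and> ?K \<subseteq> \<Union>\<F>"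
        using u by (intro exI[of _ "insert u \<F>"]) auto
    qed
    then show ?thesis using K by blast
  qed
qed

lemma Hausdorff: "Hausdorff_space space"
  unfolding Hausdorff_space_def
proof (intro allI impI)
  fix x y assume xy: "x \<in> topspace space \<and> y \<in> topspace space \<and> x \<noteq> y"
  \<comment> \<open>A clopen \<open>W\<close> separates, its complement being the open set around
    \<open>y\<close>.\<close>
  have "\<exists>W. openin space W \<and> closedin space W \<and> x \<in> W \<and> y \<notin> W"
  proof (cases "x \<in> B")
    case True
    then show ?thesis using clopen_singleton xy by blast
  next
    case False
    then have "x \<in> J" using xy by (auto simp: topspace_space)
    then show ?thesis using clopen_neighborhood[of x "{y}"] xy by blast
  qed
  then obtain W where "openin space W" "closedin space W" "x \<in> W" "y \<notin> W" by blast
  then show "\<exists>U V. openin space U \<and> openin space V \<and> x \<in> U \<and> y \<in> V \<and> disjnt U V"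
    using xy
    by (intro exI[of _ W] exI[of _ "topspace space - W"]) (auto simp: disjnt_def)
qed

lemma D_space: "D_space space"
  unfolding D_space_def open_neighborhood_assignment_def
proof (intro allI impI)
  fix U assume U: "\<forall>x\<in>topspace space. openin space (U x) \<and> x \<in> U x"
  let ?D = "J \<union> (B - (\<Union>x\<in>J. U x))"
  have cover: "topspace space = (\<Union>d\<in>?D. U d)"
  proof
    show "topspace space \<subseteq> (\<Union>d\<in>?D. U d)"
      using U by (auto simp: topspace_space)
    have "U d \<subseteq> topspace space" if "d \<in> ?D" for d
      using U that openin_subset[of space "U d"] by (auto simp: topspace_space)
    then show "(\<Union>d\<in>?D. U d) \<subseteq> topspace space" by (rule UN_least)
  qed
  have "openin (subtopology space ?D) {d}" if d: "d \<in> ?D" for d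
  proof (cases "d \<in> B")
    case True
    then show ?thesis
      using clopen_singleton[OF True] openin_subtopology_Int[of space "{d}" ?D] d by auto
  next
    case False
    then have dJ: "d \<in> J" using d by blast
    then have "openin space (insert d (L d))" "openin space (U d)" "d \<in> U d"
      using clopen_neighborhood[of d "{}"] U by (auto simp: topspace_space)
    then have "openin space (insert d (L d) \<inter> U d)" by blast
    \<comment> \<open>Points of \<open>L d\<close> lie in \<open>B\<close>, and those of them in
      \<open>U d\<close> were left out of \<open>?D\<close>.\<close>
    moreover have "insert d (L d) \<inter> U d \<inter> ?D = {d}"
      using dJ \<open>d \<in> U d\<close> L_subset[OF dJ] disjoint by blast
    ultimately show ?thesis by (metis openin_subtopology_Int)
  qed
  moreover have "?D \<subseteq> topspace space" by (auto simp: topspace_space)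
  ultimately have "subtopology space ?D = discrete_topology ?D"
    by (simp add: discrete_topology_unique eq_commute[of _ "discrete_topology _"] Int_absorb1)
  \<comment> \<open>Since \<open>?D\<close> contains \<open>J\<close>, the criterion for closedness
    has no point left to test.\<close>
  moreover have "closedin space ?D" by (auto simp: closedin_space)
  ultimately show "\<exists>D. closed_discrete_in space D \<and> topspace space = (\<Union>d\<in>D. U d)"
    using cover unfolding closed_discrete_in_def by blast
qed

lemma not_property_star:
  assumes maximal: "\<And>S. \<lbrakk>S \<subseteq> B; infinite S\<rbrakk> \<Longrightarrow> \<exists>x\<in>J. infinite (L x \<inter> S)"
    and A: "A \<subseteq> B" "regular_uncountable_cardinal |A|"
  shows "\<not> property_star space"
proof
  assume star: "property_star space"
  have uncountable: "natLeq <o |A|"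
    using A(2) by (simp add: regular_uncountable_cardinal_def)
  have "A \<subseteq> topspace space" using A(1) by (auto simp: topspace_space)
  then have "(\<exists>x. complete_accumulation_point space A x) \<or>
      (\<exists>S\<subseteq>A. |S| =o |A| \<and> closed_discrete_in space S)"
    using star[unfolded property_star_def, rule_format, of "|A|" A] A(2) card_of_refl[of A] by simp
  then consider x where "complete_accumulation_point space A x"
    | S where "S \<subseteq> A" "|S| =o |A|" "closed_discrete_in space S"
    by auto
  then show False
  proof cases
    case 1
    then obtain N where N: "neighborhood_of space x N" "countable N"
      using locally_countable
      unfolding locally_countable_space_def complete_accumulation_point_def by blast
    then have "|N \<inter> A| =o |A|"
      using 1 by (simp add: complete_accumulation_point_def)
    moreover have "|N \<inter> A| \<le>o natLeq"
      using N(2) by (metis countable_card_le_natLeq countable_Int1)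
    ultimately show False
      using uncountable not_ordLess_ordLeq ordIso_symmetric ordIso_ordLeq_trans by blast
  next
    case 2
    have "infinite A"
      using uncountable by (metis infinite_iff_natLeq_ordLeq ordLess_imp_ordLeq)
    then have "infinite S" using 2(2) card_of_ordIso_finite by blast
    then obtain x where x: "x \<in> J" "infinite (L x \<inter> S)"
      using maximal 2(1) A(1) by (metis subset_trans)
    \<comment> \<open>As \<open>S\<close> is closed and misses \<open>x\<close>, the set
      \<open>L x \<inter> S\<close> would have to be finite.\<close>
    moreover have "x \<notin> S" using 2(1) A(1) x(1) disjoint by blast
    ultimately show False
      using 2(3) by (auto simp: closed_discrete_in_def closedin_space)
  qed
qed

end

section \<open>The maximal almost disjoint family and its cardinality\<close>

text \<open>Zorn's lemma applies because almost disjointness concerns two members at a time, and two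
  members of the union of a chain already lie in one element of the chain.\<close>

lemma maximal_almost_disjoint_family:
  fixes B :: "'a set"
  obtains \<F> where "\<And>S. S \<in> \<F> \<Longrightarrow> S \<subseteq> B \<and> countable S"
    and "\<And>S T. \<lbrakk>S \<in> \<F>; T \<in> \<F>; S \<noteq> T\<rbrakk> \<Longrightarrow> finite (S \<inter> T)"
    and "\<And>S. \<lbrakk>S \<subseteq> B; infinite S\<rbrakk> \<Longrightarrow> \<exists>T\<in>\<F>. infinite (T \<inter> S)"
proof -
  define \<A> where "\<A> = {\<F>. (\<forall>S\<in>\<F>. S \<subseteq> B \<and> countable S) \<and>
    (\<forall>S\<in>\<F>. \<forall>T\<in>\<F>. S \<noteq> T \<longrightarrow> finite (S \<inter> T))}"
  have "\<exists>M\<in>\<A>. \<forall>X\<in>\<A>. M \<subseteq> X \<longrightarrow> X = M"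
  proof (rule subset_Zorn_nonempty)
    show "\<A> \<noteq> {}" unfolding \<A>_def by blast
    fix \<C> assume "\<C> \<noteq> {}" and C: "subset.chain \<A> \<C>"
    then have sub: "\<C> \<subseteq> \<A>" by (simp add: subset_chain_def)
    have "finite (S \<inter> T)" if "S \<in> \<Union>\<C>" "T \<in> \<Union>\<C>" "S \<noteq> T" for S T
    proof -
      obtain F G where FG: "F \<in> \<C>" "S \<in> F" "G \<in> \<C>" "T \<in> G" using \<open>S \<in> \<Union>\<C>\<close> \<open>T \<in> \<Union>\<C>\<close> by blast
      then have "F \<subseteq> G \<or> G \<subseteq> F" using C by (auto simp: subset_chain_def)
      then obtain H where "H \<in> \<C>" "S \<in> H" "T \<in> H" using FG by blast
      then show ?thesis using sub \<open>S \<noteq> T\<close> unfolding \<A>_def by blast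
    qed
    then show "\<Union>\<C> \<in> \<A>" using sub unfolding \<A>_def by blast
  qed
  then obtain M where M: "M \<in> \<A>" and max: "\<And>X. \<lbrakk>X \<in> \<A>; M \<subseteq> X\<rbrakk> \<Longrightarrow> X = M" by blast
  have "\<exists>T\<in>M. infinite (T \<inter> S)" if S: "S \<subseteq> B" "infinite S" for S
  proof (rule ccontr)
    assume fin: "\<not> (\<exists>T\<in>M. infinite (T \<inter> S))"
    \<comment> \<open>Only countable sets may be adjoined to \<open>M\<close>, so \<open>S\<close>
      is first thinned out.\<close>
    obtain S' where S': "S' \<subseteq> S" "countable S'" "infinite S'"
      using infinite_countable_subset'[OF S(2)] by blast
    have fin': "finite (T \<inter> S')" if "T \<in> M" for T
      by (rule finite_subset[of _ "T \<inter> S"]) (use fin that S'(1) in auto)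
    moreover have "finite (S' \<inter> T)" if "T \<in> M" for T
      using fin'[OF that] by (simp add: Int_commute)
    ultimately have "insert S' M \<in> \<A>" using M S' S(1) unfolding \<A>_def by auto
    then have "S' \<in> M" using max by blast
    \<comment> \<open>With \<open>T = S'\<close>, the intersection \<open>T \<inter> S'\<close> is
      the infinite set \<open>S'\<close> itself.\<close>
    then show False using fin' S'(3) by force
  qed
  then show ?thesis using that[of M] M unfolding \<A>_def by blast
qed

text \<open>A countable set of reals is coded by a relation on the naturals whose rows list the
  \<open>h\<close>-codes of its elements. It is enough that \<open>decode\<close> hits every
  countable set; its other values are harmless.\<close>

lemma countable_sets_lepoll_reals: "{S :: real set. countable S} \<lesssim> (UNIV :: real set)"
proof -
  obtain h :: "real \<Rightarrow> nat set" where h: "inj h"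
    using nat_sets_eqpoll_reals by (meson eqpoll_imp_lepoll eqpoll_sym lepoll_def)
  define decode :: "(nat \<times> nat) set \<Rightarrow> real set" where
    "decode r = {x. \<exists>n. (n, 0) \<in> r \<and> h x = {m. (n, Suc m) \<in> r}}" for r
  have "S \<in> range decode" if "countable S" for S
  proof
    define r where "r = (\<Union>x\<in>S. {to_nat_on S x} \<times> insert 0 (Suc ` h x))"
    have code: "(to_nat_on S x, 0) \<in> r" "{m. (to_nat_on S x, Suc m) \<in> r} = h x" if "x \<in> S" for x
      using that \<open>countable S\<close> by (auto simp: r_def)
    show "S = decode r"
    proof
      show "S \<subseteq> decode r" using code unfolding decode_def by blast
      show "decode r \<subseteq> S"
      proof
        fix x assume "x \<in> decode r"
        then obtain n where n: "(n, 0) \<in> r" "h x = {m. (n, Suc m) \<in> r}"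
          unfolding decode_def by blast
        then obtain y where "y \<in> S" "n = to_nat_on S y" by (auto simp: r_def)
        then have "h x = h y" using n(2) code(2) by simp
        then show "x \<in> S" using h \<open>y \<in> S\<close> by (simp add: inj_eq)
      qed
    qed
  qed simp
  then have "{S. countable S} \<subseteq> range decode" by blast
  then have "{S :: real set. countable S} \<lesssim> (UNIV :: (nat \<times> nat) set set)"
    by (rule subset_image_lepoll)
  also have "\<dots> \<lesssim> (UNIV :: nat set set)"
    unfolding lepoll_def
    by (rule exI[of _ "image prod_encode"]) (simp add: inj_image_eq_iff inj_on_def)
  also have "\<dots> \<approx> (UNIV :: real set)" by (rule nat_sets_eqpoll_reals)
  finally show ?thesis .
qed

section \<open>The continuum and its regular uncountable subcardinals\<close>

lemma continuum_eq_card_reals: "|UNIV :: real set| =o ctwo ^c natLeq"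
proof -
  have "|UNIV :: real set| =o |UNIV :: nat set set|"
    using nat_sets_eqpoll_reals by (meson eqpoll_sym eqpoll_iff_card_of_ordIso)
  also have "|UNIV :: nat set set| =o ctwo ^c natLeq"
    using card_of_Pow_Func[of "UNIV :: nat set"]
    by (simp add: cexp_def ctwo_def Field_natLeq Field_card_of)
  finally show ?thesis .
qed

text \<open>The continuum itself may be singular, so \<open>A\<close> is a copy of \<omega>_1, the
  cardinal successor of \<open>natLeq\<close>. Successors of infinite cardinals are regular, and
  \<omega>_1 is at most the continuum by Cantor's theorem.\<close>

lemma regular_uncountable_subset:
  assumes "(UNIV :: nat set set) \<lesssim> B"
  obtains A where "A \<subseteq> B" "regular_uncountable_cardinal |A|"
proof -
  let ?k = "cardSuc natLeq"
  have "natLeq <o |UNIV :: nat set set|"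
    using card_of_Pow[of "UNIV :: nat set"] card_of_nat ordIso_ordLess_trans ordIso_symmetric
    by fastforce
  then have "?k \<le>o |UNIV :: nat set set|"
    using cardSuc_ordLess_ordLeq[OF natLeq_Card_order card_of_Card_order] by blast
  moreover have "|UNIV :: nat set set| \<le>o |B|"
    using assms by (simp add: lepoll_def card_of_ordLeq)
  ultimately have "|Field ?k| \<le>o |B|"
    using card_of_Field_ordIso[OF cardSuc_Card_order[OF natLeq_Card_order]]
      ordIso_ordLeq_trans ordLeq_transitive by blast
  then obtain g where g: "inj_on g (Field ?k)" "g ` Field ?k \<subseteq> B"
    by (auto simp flip: card_of_ordLeq)
  let ?A = "g ` Field ?k"
  have "|Field ?k| =o |?A|"
    using g(1) card_of_ordIso inj_on_imp_bij_betw by blast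
  then have k: "?k =o |?A|"
    using card_of_Field_ordIso[OF cardSuc_Card_order[OF natLeq_Card_order]]
      ordIso_symmetric ordIso_transitive by blast
  have "regularCard |?A|"
    using regularCard_ordIso[OF k Cinfinite_cardSuc regularCard_cardSuc] natLeq_Cinfinite by blast
  moreover have "natLeq <o |?A|"
    using cardSuc_greater[OF natLeq_Card_order] k ordLess_ordIso_trans by blast
  ultimately show ?thesis
    using that[of ?A] g(2) by (simp add: regular_uncountable_cardinal_def card_of_Card_order)
qed

section \<open>Realization of the space on the real line\<close>

theorem theorem3p9:
  shows "\<exists>X :: real topology.
           locally_countable_space X \<and>
           locally_compact_space X \<and>
           zero_dimensional_space X \<and>
           Hausdorff_space X \<and>
           D_space X \<and>
           |topspace X| =o ctwo ^c natLeq \<and>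
           \<not> property_star X"
proof -
  \<comment> \<open>\<open>?B\<close> carries the isolated base set; the disjoint interval
    \<open>?R\<close> supplies one new point for each member of the family.\<close>
  let ?B = "{0<..<1} :: real set" and ?R = "{1<..<2} :: real set"
  obtain \<F> where F: "\<And>S. S \<in> \<F> \<Longrightarrow> S \<subseteq> ?B \<and> countable S"
    and ad: "\<And>S T. \<lbrakk>S \<in> \<F>; T \<in> \<F>; S \<noteq> T\<rbrakk> \<Longrightarrow> finite (S \<inter> T)"
    and max: "\<And>S. \<lbrakk>S \<subseteq> ?B; infinite S\<rbrakk> \<Longrightarrow> \<exists>T\<in>\<F>. infinite (T \<inter> S)"
    by (rule maximal_almost_disjoint_family[of ?B]) blast
  have BR: "?B \<approx> (UNIV :: real set)" "?R \<approx> (UNIV :: real set)"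
    by (simp_all add: open_interval_eqpoll_reals)
  have "\<F> \<lesssim> {S :: real set. countable S}"
    using F by (intro subset_imp_lepoll) blast
  also have "\<dots> \<lesssim> (UNIV :: real set)" by (rule countable_sets_lepoll_reals)
  also have "\<dots> \<approx> ?R" using BR(2) by (rule eqpoll_sym)
  finally obtain e where e: "inj_on e \<F>" "e ` \<F> \<subseteq> ?R" by (auto simp: lepoll_def)
  \<comment> \<open>The point \<open>e S\<close> stands for the member \<open>S\<close>, which
    \<open>inv_into \<F> e\<close> recovers by injectivity.\<close>
  interpret mrowka ?B "e ` \<F>" "inv_into \<F> e"
  proof
    show "?B \<inter> e ` \<F> = {}" using e(2) by fastforce
    show "inv_into \<F> e x \<subseteq> ?B" "countable (inv_into \<F> e x)" if "x \<in> e ` \<F>" for x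
      using F inv_into_into[OF that] by blast+
    show "finite (inv_into \<F> e x \<inter> inv_into \<F> e y)"
      if "x \<in> e ` \<F>" "y \<in> e ` \<F>" "x \<noteq> y" for x y
      using ad inv_into_into that inv_into_injective by metis
  qed
  have "topspace space \<approx> (UNIV :: real set)"
  proof (rule lepoll_antisym)
    show "topspace space \<lesssim> (UNIV :: real set)" by (simp add: subset_imp_lepoll)
    have "(UNIV :: real set) \<lesssim> ?B" using BR(1) eqpoll_imp_lepoll eqpoll_sym by blast
    also have "?B \<lesssim> topspace space" by (simp add: topspace_space subset_imp_lepoll)
    finally show "(UNIV :: real set) \<lesssim> topspace space" .
  qed
  then have "|topspace space| =o ctwo ^c natLeq"
    using continuum_eq_card_reals ordIso_transitive eqpoll_iff_card_of_ordIso by blast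
  moreover have "(UNIV :: nat set set) \<lesssim> ?B"
    using nat_sets_eqpoll_reals BR(1) by (meson eqpoll_imp_lepoll eqpoll_sym eqpoll_trans)
  then obtain A where "A \<subseteq> ?B" "regular_uncountable_cardinal |A|"
    by (rule regular_uncountable_subset)
  \<comment> \<open>Maximality of \<open>\<F>\<close> is carried over to the index points.\<close>
  moreover have "\<exists>x\<in>e ` \<F>. infinite (inv_into \<F> e x \<inter> S)" if "S \<subseteq> ?B" "infinite S" for S
    using max[OF that] e(1) by simp
  ultimately show ?thesis
    using locally_countable locally_compact zero_dimensional Hausdorff D_space not_property_star
    by blast
qed

end
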